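(* As formal power series in $u$ with coefficients in $\mathbb{Q}[t]$, $$\sum_{n\ge1}\chi_{\Pi_{\Gamma_{2n+2}}}(t)\,u^n=(t-1)\sum_{n\ge1}\frac{\bigl((t-1)_n\bigr)^2u^n}{\prod_{k=1}^n\bigl(1-k(t-k)u\bigr)}.$$ Equivalently, $$\sum_{n\ge1}\chi_{L_{2n+2}}(t)\,u^n=\sum_{n\ge1}\frac{\bigl((t-2)_{n-1}\bigr)^2u^n}{\prod_{k=1}^n\bigl(1-k(t-k)u\bigr)}.$$ Here $(a)_m=a(a-1)\cdots(a-m+1)$ (and $(a)_0=1$).
   Context: For a finite set $V\subset\mathbb{Z}_{>0}$, $\Gamma_V$ is the bipartite graph on vertex set $V$ with an edge $\{u,v\}$ for each $u<v$ in $V$ with $u$ odd and $v$ even; $\Gamma_{2n}:=\Gamma_{[2n]}$ where $[2n]=\{1,\dots,2n\}$. For a finite graph $G$ with vertex set $V$, the bond lattice $\Pi_G$ is the set of partitions $\pi$ of $V$ such that the induced subgraph of $G$ on each block is connected, ordered by: $\pi\le\pi'$ iff every block of $\pi$ is contained in a block of $\pi'$. For $n\ge2$, $L_{2n}$ is the induced subposet of $\Pi_{\Gamma_{[2n]\setminus\{2,2n-1\}}}$ consisting of the partitions in which $1$ and $2n$ are in distinct blocks. For a finite ranked poset $P$ of length $\ell$ with minimum $\hat0$, Möbius function $\mu_P$ and rank function $\mathrm{rk}$, the characteristic polynomial is $\chi_P(t)=\sum_{x\in P}\mu_P(\hat0,x)t^{\ell-\mathrm{rk}(x)}$. *)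

theory Defs
  imports
    "HOL-Library.Disjoint_Sets"
    "HOL-Computational_Algebra.Computational_Algebra"
begin

section \<open>Finite posets and characteristic polynomials\<close>

text \<open>A poset is given by its carrier \<open>P\<close> and a relation \<open>le\<close>, of which only the restriction to
  \<open>P\<close> matters; an induced subposet is obtained by shrinking \<open>P\<close> and keeping \<open>le\<close>.\<close>

locale finite_poset =
  fixes P :: "'a set" and le :: "'a \<Rightarrow> 'a \<Rightarrow> bool"
  assumes finite_carrier: "finite P"
    and refl_le: "reflp_on P le"
    and antisym_le: "antisymp_on P le"
    and trans_le: "transp_on P le"
begin

function mobius :: "'a \<Rightarrow> 'a \<Rightarrow> int" where
  "mobius x y =
    (if x \<in> P \<and> y \<in> P \<and> le x y then
       (if x = y then 1 else - (\<Sum>z\<in>{z \<in> P. le x z \<and> le z y \<and> z \<noteq> y}. mobius x z))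
     else 0)"
  by auto
termination
proof (relation "measure (\<lambda>(x, y). card {w \<in> P. le w y})", goal_cases)
  case 1
  show ?case by simp
next
  case (2 x y z)
  have z: "z \<in> P" "le z y" "z \<noteq> y" and y: "y \<in> P" using 2 by auto
  have "y \<in> {w \<in> P. le w y}" using y refl_le by (auto simp: reflp_on_def)
  moreover have "y \<notin> {w \<in> P. le w z}"
    using z y antisym_le by (auto dest: antisymp_onD)
  moreover have "{w \<in> P. le w z} \<subseteq> {w \<in> P. le w y}"
    using z y trans_le by (auto dest: transp_onD)
  ultimately have "{w \<in> P. le w z} \<subset> {w \<in> P. le w y}" by blast
  then show ?case using finite_carrier by (simp add: psubset_card_mono)
qed

declare mobius.simps [simp del]

end

definition poset_bot :: "'a set \<Rightarrow> ('a \<Rightarrow> 'a \<Rightarrow> bool) \<Rightarrow> 'a" where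
  "poset_bot P le = (THE b. b \<in> P \<and> (\<forall>x\<in>P. le b x))"

definition poset_length :: "'a set \<Rightarrow> ('a \<Rightarrow> 'a \<Rightarrow> bool) \<Rightarrow> nat" where
  "poset_length P le = Max {card C - 1 | C. C \<subseteq> P \<and> C \<noteq> {} \<and> totalp_on C le}"

text \<open>In a ranked poset with minimum, all maximal chains from the minimum to \<open>x\<close> have the same
  length; the rank of \<open>x\<close> is that length.\<close>

definition poset_rank :: "'a set \<Rightarrow> ('a \<Rightarrow> 'a \<Rightarrow> bool) \<Rightarrow> 'a \<Rightarrow> nat" where
  "poset_rank P le x = poset_length {y \<in> P. le y x} le"

definition poset_char_poly :: "'a set \<Rightarrow> ('a \<Rightarrow> 'a \<Rightarrow> bool) \<Rightarrow> rat poly" where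
  "poset_char_poly P le =
    (\<Sum>x\<in>P. monom (of_int (finite_poset.mobius P le (poset_bot P le) x))
               (poset_length P le - poset_rank P le x))"


section \<open>Bond lattices\<close>

text \<open>A graph is given by its vertex set and its set of edges, each edge being a two-element set
  of vertices.\<close>

definition induced_connected :: "'v set set \<Rightarrow> 'v set \<Rightarrow> bool" where
  "induced_connected E S \<longleftrightarrow>
    (\<forall>u\<in>S. \<forall>v\<in>S. (u, v) \<in> {(x, y). x \<in> S \<and> y \<in> S \<and> {x, y} \<in> E}\<^sup>*)"

text \<open>The bond lattice is ordered by \<^term>\<open>refines V\<close>.\<close>

definition bond_lattice :: "'v set \<Rightarrow> 'v set set \<Rightarrow> 'v set set set" where
  "bond_lattice V E = {\<pi>. partition_on V \<pi> \<and> (\<forall>B\<in>\<pi>. induced_connected E B)}"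

lemma finite_poset_bond_lattice_subset:
  assumes "finite V" and "P \<subseteq> bond_lattice V E"
  shows "finite_poset P (refines V)"
proof
  have sub: "P \<subseteq> {\<pi>. partition_on V \<pi>}" using assms(2) by (auto simp: bond_lattice_def)
  show "finite P" using finite_subset[OF sub] finitely_many_partition_on[OF assms(1)] by simp
  show "reflp_on P (refines V)" using sub by (auto intro!: reflp_onI refines_refl)
  show "antisymp_on P (refines V)" by (auto intro!: antisymp_onI refines_asym)
  show "transp_on P (refines V)" by (auto intro!: transp_onI elim: refines_trans)
qed

lemma poset_bot_bond_lattice_subset:
  assumes "P \<subseteq> bond_lattice V E" and "(\<lambda>v. {v}) ` V \<in> P"
  shows "poset_bot P (refines V) = (\<lambda>v. {v}) ` V"
  unfolding poset_bot_def
proof (rule the_equality)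
  have le: "refines V ((\<lambda>v. {v}) ` V) \<pi>" if "\<pi> \<in> P" for \<pi>
    using that assms by (fastforce simp: refines_def bond_lattice_def partition_on_def)
  show "(\<lambda>v. {v}) ` V \<in> P \<and> (\<forall>x\<in>P. refines V ((\<lambda>v. {v}) ` V) x)"
    using assms(2) le by blast
  show "b = (\<lambda>v. {v}) ` V" if "b \<in> P \<and> (\<forall>x\<in>P. refines V b x)" for b
    using that le assms(2) refines_asym by blast
qed


section \<open>The graphs and posets of the theorem\<close>

definition Gamma_edges :: "nat set \<Rightarrow> nat set set" where
  "Gamma_edges V = {{u, v} | u v. u \<in> V \<and> v \<in> V \<and> u < v \<and> odd u \<and> even v}"

definition Pi_Gamma :: "nat set \<Rightarrow> nat set set set" where
  "Pi_Gamma V = bond_lattice V (Gamma_edges V)"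

text \<open>The index \<open>N\<close> below is the even number \<open>2n\<close> with \<open>n \<ge> 2\<close>.\<close>

definition L_vertices :: "nat \<Rightarrow> nat set" where
  "L_vertices N = {1..N} - {2, N - 1}"

definition L_poset :: "nat \<Rightarrow> nat set set set" where
  "L_poset N = {\<pi> \<in> Pi_Gamma (L_vertices N). \<not> (\<exists>B\<in>\<pi>. 1 \<in> B \<and> N \<in> B)}"

lemma singletons_in_Pi_Gamma: "(\<lambda>v. {v}) ` V \<in> Pi_Gamma V"
  by (auto simp: Pi_Gamma_def bond_lattice_def induced_connected_def partition_on_def disjoint_def)

lemma singletons_in_L_poset:
  assumes "N \<noteq> 1"
  shows "(\<lambda>v. {v}) ` L_vertices N \<in> L_poset N"
  using assms singletons_in_Pi_Gamma by (auto simp: L_poset_def)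

definition chi_Pi :: "nat \<Rightarrow> rat poly" where
  "chi_Pi N = poset_char_poly (Pi_Gamma {1..N}) (refines {1..N})"

definition chi_L :: "nat \<Rightarrow> rat poly" where
  "chi_L N = poset_char_poly (L_poset N) (refines (L_vertices N))"


section \<open>Power series over polynomials\<close>

definition falling :: "'a::comm_ring_1 \<Rightarrow> nat \<Rightarrow> 'a" where
  "falling a m = (\<Prod>i<m. a - of_nat i)"

abbreviation tvar :: "rat poly" where
  "tvar \<equiv> [:0, 1:]"

definition denom :: "nat \<Rightarrow> rat poly fps" where
  "denom n = (\<Prod>k=1..n. 1 - fps_const (of_nat k * (tvar - of_nat k)) * fps_X)"

text \<open>The coefficient ring is not a field, so the generic division of power series is not
  available; a series with constant coefficient 1 is inverted by
  \<^term>\<open>\<lambda>f. fps_right_inverse f 1\<close>.\<close>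

definition inv_denom :: "nat \<Rightarrow> rat poly fps" where
  "inv_denom n = fps_right_inverse (denom n) 1"

lemma denom_times_inv_denom: "denom n * inv_denom n = 1"
proof -
  have "fps_nth (denom n) 0 = 1"
    by (induction n) (simp_all add: denom_def)
  then show ?thesis
    unfolding inv_denom_def by (intro fps_right_inverse) simp
qed

text \<open>All series in the theorem converge in the \<open>u\<close>-adic topology.\<close>

lemma sums_fps_X_power:
  fixes f :: "nat \<Rightarrow> rat poly fps"
  shows "(\<lambda>n. f n * fps_X ^ Suc n) sums Abs_fps (\<lambda>m. \<Sum>n<m. fps_nth (f n) (m - Suc n))"
  unfolding sums_def
proof (rule tendsto_fpsI)
  fix m
  have "fps_nth (\<Sum>n<k. f n * fps_X ^ Suc n) m = (\<Sum>n<m. fps_nth (f n) (m - Suc n))"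
    if "k \<ge> m" for k
  proof -
    have "fps_nth (\<Sum>n<k. f n * fps_X ^ Suc n) m =
        (\<Sum>n<k. if m < Suc n then 0 else fps_nth (f n) (m - Suc n))"
      by (simp add: fps_sum_nth fps_X_power_mult_right_nth del: power_Suc)
    also have "\<dots> = (\<Sum>n<m. fps_nth (f n) (m - Suc n))"
      using that by (intro sum.mono_neutral_cong_right) auto
    finally show ?thesis .
  qed
  then show "\<forall>\<^sub>F k in sequentially. fps_nth (\<Sum>n<k. f n * fps_X ^ Suc n) m =
      fps_nth (Abs_fps (\<lambda>m. \<Sum>n<m. fps_nth (f n) (m - Suc n))) m"
    by (auto simp: eventually_sequentially)
qed

end

theory Submission
  imports Defs
begin

text \<open>By Moebius inversion over the partitions separating a set \<open>W\<close> of pinned vertices, the value at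
  \<open>q\<close> of the characteristic polynomial is the number of proper \<open>q\<close>-colorings extending a fixed
  injective coloring of \<open>W\<close>; here \<open>W = {1}\<close> for the bond lattice and \<open>W = {1, N}\<close> for \<open>L_poset N\<close>.
  In \<open>Gamma_edges\<close>, color the pairs \<open>(3, 4), (5, 6), \<dots>\<close> in increasing order and let \<open>k\<close> be the
  number of colors seen on odd vertices. If the odd vertex repeats one of the \<open>k\<close> colors, the pair
  contributes \<open>k (q - k)\<close>; if it takes a color that is new and differs from that of \<open>N\<close>, it contributes
  \<open>(q - 1 - k)\<^sup>2\<close> and \<open>k\<close> grows by one. Unrolling this recursion gives the second series, and the
  first one follows since \<open>2\<close>, \<open>N - 1\<close> and \<open>N\<close> contribute a factor \<open>q - 1\<close> each.\<close>

section \<open>List colorings\<close>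

text \<open>With \<open>PiE\<close>, a coloring is determined by its values on \<open>V\<close>, so
  colorings can be counted. Edges of \<open>E\<close> that leave \<open>V\<close> impose no
  condition, which allows \<open>E\<close> to stay fixed while vertices are removed from
  \<open>V\<close>.\<close>

definition list_colorings :: "'v set \<Rightarrow> 'v set set \<Rightarrow> ('v \<Rightarrow> 'c set) \<Rightarrow> ('v \<Rightarrow> 'c) set" where
  "list_colorings V E L =
     {f \<in> PiE V L. \<forall>x\<in>V. \<forall>y\<in>V. {x, y} \<in> E \<longrightarrow> f x \<noteq> f y}"

lemma list_colorings_cong:
  assumes "\<And>v. v \<in> V \<Longrightarrow> L v = L' v"
    and "\<And>x y. x \<in> V \<Longrightarrow> y \<in> V \<Longrightarrow> {x, y} \<in> E \<longleftrightarrow> {x, y} \<in> E'"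
  shows "list_colorings V E L = list_colorings V E' L'"
proof -
  have "PiE V L = PiE V L'" using assms(1) by (rule PiE_cong)
  then show ?thesis using assms(2) by (auto simp: list_colorings_def)
qed

lemma finite_list_colorings:
  assumes "finite V" "\<And>v. v \<in> V \<Longrightarrow> finite (L v)"
  shows "finite (list_colorings V E L)"
  using finite_PiE[OF assms] by (simp add: list_colorings_def)

text \<open>Color \<open>v\<close> first: choosing \<open>c\<close> deletes \<open>c\<close> from
  the lists of the neighbors of \<open>v\<close>, and nothing else links \<open>v\<close> to the
  rest. The map sending \<open>(c, g)\<close> to \<open>g(v := c)\<close> is then a bijection onto
  the colorings.\<close>

lemma card_list_colorings_insert:
  assumes "finite V" "v \<notin> V" "{v} \<notin> E" "\<And>w. w \<in> insert v V \<Longrightarrow> finite (L w)"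
  shows "card (list_colorings (insert v V) E L) =
    (\<Sum>c\<in>L v. card (list_colorings V E (\<lambda>w. if {v, w} \<in> E then L w - {c} else L w)))"
proof -
  let ?A = "\<lambda>c. list_colorings V E (\<lambda>w. if {v, w} \<in> E then L w - {c} else L w)"
  let ?h = "\<lambda>(c, g). g(v := c)"
  have sub: "g \<in> PiE V L" if "g \<in> ?A c" for c g
  proof -
    have g: "g \<in> PiE V (\<lambda>w. if {v, w} \<in> E then L w - {c} else L w)"
      using that by (simp add: list_colorings_def)
    show ?thesis by (rule subsetD[OF PiE_mono g]) auto
  qed
  have "list_colorings (insert v V) E L = ?h ` Sigma (L v) ?A"
  proof (intro set_eqI iffI)
    fix f assume f: "f \<in> list_colorings (insert v V) E L"
    then have "f \<in> PiE (insert v V) L" by (simp add: list_colorings_def)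
    then obtain c g where cg: "c \<in> L v" "g \<in> PiE V L" "f = g(v := c)"
      unfolding PiE_insert_eq by auto
    have *: "x \<noteq> v" if "x \<in> V" for x using that assms(2) by auto
    have "f x \<noteq> f y" if "x \<in> insert v V" "y \<in> insert v V" "{x, y} \<in> E" for x y
      using f that unfolding list_colorings_def by blast
    then have ne: "f x \<noteq> f y" if "x \<in> insert v V" "y \<in> insert v V" "{x, y} \<in> E" for x y
      using that by blast
    have "g x \<noteq> g y" if "x \<in> V" "y \<in> V" "{x, y} \<in> E" for x y
      using ne[of x y] that cg(3) * by simp
    moreover have "g x \<noteq> c" if "x \<in> V" "{v, x} \<in> E" for x
      using ne[of v x] that cg(3) * by auto
    ultimately have "g \<in> ?A c"
      using cg(2) by (auto simp: list_colorings_def PiE_iff)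
    then show "f \<in> ?h ` Sigma (L v) ?A" using cg by auto
  next
    fix f assume "f \<in> ?h ` Sigma (L v) ?A"
    then obtain c g where cg: "c \<in> L v" "g \<in> ?A c" "f = g(v := c)" by auto
    have "(c, g) \<in> L v \<times> PiE V L" using cg(1) sub[OF cg(2)] by simp
    then have "f \<in> PiE (insert v V) L"
      unfolding PiE_insert_eq cg(3) by (metis (no_types, lifting) case_prod_conv image_eqI)
    moreover have "g w \<noteq> c" if "w \<in> V" "{v, w} \<in> E" for w
      using cg(2) that by (auto simp: list_colorings_def PiE_iff)
    moreover have "g x \<noteq> g y" if "x \<in> V" "y \<in> V" "{x, y} \<in> E" for x y
      using cg(2) that by (auto simp: list_colorings_def)
    ultimately show "f \<in> list_colorings (insert v V) E L"
      using cg(3) assms(2,3) by (auto simp: list_colorings_def insert_commute)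
  qed
  moreover have "inj_on ?h (Sigma (L v) ?A)"
  proof (rule inj_on_subset[OF inj_combinator])
    show "v \<notin> V" by fact
    show "Sigma (L v) ?A \<subseteq> L v \<times> PiE V L" using sub by blast
  qed
  ultimately have "card (list_colorings (insert v V) E L) = card (Sigma (L v) ?A)"
    by (simp add: card_image)
  also have "\<dots> = (\<Sum>c\<in>L v. card (?A c))"
    using assms by (subst card_SigmaI) (auto intro!: finite_list_colorings)
  finally show ?thesis .
qed

text \<open>Allows the reduced lists to be written as any family \<open>L' c\<close> that agrees
  with them on \<open>V\<close>, so that repeated deletions keep a recognizable shape.\<close>

lemma card_list_colorings_insert_eq:
  assumes "finite V" "v \<notin> V" "{v} \<notin> E" "\<And>w. w \<in> insert v V \<Longrightarrow> finite (L w)" "L v = A"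
    and "\<And>c w. c \<in> A \<Longrightarrow> w \<in> V \<Longrightarrow> L' c w = (if {v, w} \<in> E then L w - {c} else L w)"
  shows "card (list_colorings (insert v V) E L) = (\<Sum>c\<in>A. card (list_colorings V E (L' c)))"
proof -
  have "list_colorings V E (\<lambda>w. if {v, w} \<in> E then L w - {c} else L w) = list_colorings V E (L' c)"
    if "c \<in> A" for c
    using assms(6)[OF that] by (intro list_colorings_cong) simp_all
  then show ?thesis using card_list_colorings_insert[OF assms(1-4)] assms(5) by simp
qed

section \<open>Moebius inversion over bond partitions\<close>

definition monochromatic :: "'v set \<Rightarrow> 'v set set \<Rightarrow> ('v \<Rightarrow> 'c) \<Rightarrow> ('v \<times> 'v) set" where
  "monochromatic V E f = {(x, y). x \<in> V \<and> y \<in> V \<and> {x, y} \<in> E \<and> f x = f y}"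

text \<open>By \<open>refines_color_components_iff\<close> below, this is the coarsest bond
  partition with \<open>f\<close> constant on each block. The closure is reflexive on the whole
  type; the intersection with \<open>V \<times> V\<close> makes it an equivalence relation on
  \<open>V\<close>.\<close>

definition color_components :: "'v set \<Rightarrow> 'v set set \<Rightarrow> ('v \<Rightarrow> 'c) \<Rightarrow> 'v set set" where
  "color_components V E f = V // ((monochromatic V E f)\<^sup>* \<inter> V \<times> V)"

lemma equiv_monochromatic: "equiv V ((monochromatic V E f)\<^sup>* \<inter> V \<times> V)"
proof (rule equivI)
  have "sym (monochromatic V E f)"
    by (auto simp: sym_def monochromatic_def insert_commute)
  then have "sym ((monochromatic V E f)\<^sup>*)" by (rule sym_rtrancl)
  then show "sym ((monochromatic V E f)\<^sup>* \<inter> V \<times> V)" by (auto simp: sym_def)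
  show "trans ((monochromatic V E f)\<^sup>* \<inter> V \<times> V)"
    by (auto simp: trans_def intro: rtrancl_trans)
qed (auto simp: refl_on_def)

lemma monochromatic_same_color:
  assumes "(x, y) \<in> (monochromatic V E f)\<^sup>*"
  shows "f x = f y"
  using assms by (induction rule: rtrancl_induct) (auto simp: monochromatic_def)

lemma color_components_constant:
  assumes "B \<in> color_components V E f" "x \<in> B" "y \<in> B"
  shows "f x = f y"
proof -
  have "(x, y) \<in> (monochromatic V E f)\<^sup>* \<inter> V \<times> V"
    using quotient_eq_iff[OF equiv_monochromatic] assms
    unfolding color_components_def by metis
  then show ?thesis using monochromatic_same_color by auto
qed

lemma color_components_in_bond_lattice: "color_components V E f \<in> bond_lattice V E"
  unfolding bond_lattice_def mem_Collect_eq
proof (intro conjI ballI)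
  show "partition_on V (color_components V E f)"
    unfolding color_components_def by (rule partition_on_quotient[OF equiv_monochromatic])
  fix B assume "B \<in> color_components V E f"
  then obtain x where x: "x \<in> V" "B = ((monochromatic V E f)\<^sup>* \<inter> V \<times> V) `` {x}"
    unfolding color_components_def by (auto elim: quotientE)
  let ?R = "{(x, y). x \<in> B \<and> y \<in> B \<and> {x, y} \<in> E}"
  show "induced_connected E B"
    unfolding induced_connected_def
  proof (intro ballI)
    fix u v assume "u \<in> B" "v \<in> B"
    then have "(u, v) \<in> (monochromatic V E f)\<^sup>*"
      using quotient_eq_iff[OF equiv_monochromatic] \<open>B \<in> _\<close>
      unfolding color_components_def by (metis IntD1)
    \<comment> \<open>The induction carries \<open>v \<in> B\<close> along: a monochromatic path
      never leaves its class, so its edges lie in the induced subgraph.\<close>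
    then have "v \<in> B \<and> (u, v) \<in> ?R\<^sup>*"
    proof (induction rule: rtrancl_induct)
      case base then show ?case using \<open>u \<in> B\<close> by simp
    next
      case (step y z)
      have "z \<in> B" using step x by (auto simp: monochromatic_def intro: rtrancl_into_rtrancl
           elim: rtrancl_into_rtrancl[where c=z])
      moreover have "(y, z) \<in> ?R"
        using step \<open>z \<in> B\<close> by (auto simp: monochromatic_def)
      ultimately show ?case using step by (meson rtrancl.rtrancl_into_rtrancl)
    qed
    then show "(u, v) \<in> ?R\<^sup>*" by simp
  qed
qed

text \<open>A block is connected by edges of \<open>E\<close>; if \<open>f\<close> is constant on
  it, these edges are monochromatic and the block lies in one component. Conversely,
  \<open>f\<close> is constant along monochromatic paths.\<close>

lemma refines_color_components_iff:
  assumes "\<pi> \<in> bond_lattice V E"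
  shows "refines V \<pi> (color_components V E f) \<longleftrightarrow> (\<forall>B\<in>\<pi>. \<forall>x\<in>B. \<forall>y\<in>B. f x = f y)"
proof
  assume ref: "refines V \<pi> (color_components V E f)"
  show "\<forall>B\<in>\<pi>. \<forall>x\<in>B. \<forall>y\<in>B. f x = f y"
  proof (intro ballI)
    fix B x y assume "B \<in> \<pi>" "x \<in> B" "y \<in> B"
    moreover from this ref obtain Y where "Y \<in> color_components V E f" "B \<subseteq> Y"
      unfolding refines_def by blast
    ultimately show "f x = f y" using color_components_constant[of Y V E f x y] by blast
  qed
next
  assume const: "\<forall>B\<in>\<pi>. \<forall>x\<in>B. \<forall>y\<in>B. f x = f y"
  have part: "partition_on V \<pi>" and conn: "\<And>B. B \<in> \<pi> \<Longrightarrow> induced_connected E B"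
    using assms by (auto simp: bond_lattice_def)
  have "\<exists>Y\<in>color_components V E f. B \<subseteq> Y" if B: "B \<in> \<pi>" for B
  proof -
    have BV: "B \<subseteq> V" and "B \<noteq> {}" using part B by (auto simp: partition_on_def)
    then obtain x where x: "x \<in> B" by auto
    have "{(x, y). x \<in> B \<and> y \<in> B \<and> {x, y} \<in> E} \<subseteq> monochromatic V E f"
      using const B BV by (auto simp: monochromatic_def)
    then have "(x, y) \<in> (monochromatic V E f)\<^sup>*" if "y \<in> B" for y
      using conn[OF B] x that rtrancl_mono unfolding induced_connected_def by blast
    then have "B \<subseteq> ((monochromatic V E f)\<^sup>* \<inter> V \<times> V) `` {x}" using x BV by auto
    moreover have "\<dots> \<in> color_components V E f"
      unfolding color_components_def using x BV by (auto intro: quotientI)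
    ultimately show ?thesis by blast
  qed
  then show "refines V \<pi> (color_components V E f)"
    using part color_components_in_bond_lattice[of V E f]
    by (auto simp: refines_def bond_lattice_def)
qed

text \<open>Without loops, a monochromatic edge joins two different vertices and so forces a
  component with more than one element.\<close>

lemma color_components_eq_singletons_iff:
  assumes "\<And>x. {x} \<notin> E"
  shows "color_components V E f = (\<lambda>v. {v}) ` V \<longleftrightarrow>
    (\<forall>x\<in>V. \<forall>y\<in>V. {x, y} \<in> E \<longrightarrow> f x \<noteq> f y)" (is "?l \<longleftrightarrow> ?r")
proof
  assume l: ?l
  show ?r
  proof (intro ballI impI notI)
    fix x y assume xy: "x \<in> V" "y \<in> V" "{x, y} \<in> E" "f x = f y"
    let ?C = "((monochromatic V E f)\<^sup>* \<inter> V \<times> V) `` {x}"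
    have "?C \<in> (\<lambda>v. {v}) ` V"
      using l xy unfolding color_components_def by (metis quotientI)
    then obtain v where "?C = {v}" by blast
    moreover have "x \<in> ?C" "y \<in> ?C" using xy by (auto simp: monochromatic_def)
    ultimately have "x = y" by (metis singletonD)
    then show False using xy assms by auto
  qed
next
  assume ?r
  then have "monochromatic V E f = {}" by (auto simp: monochromatic_def)
  then show ?l unfolding color_components_def quotient_def by auto
qed

text \<open>Such a function amounts to one color per block, admissible for every vertex of the
  block. The bijection evaluates at a representative \<open>?r B\<close>; its inverse looks up the
  block \<open>?b v\<close> of each vertex.\<close>

lemma card_blockwise_constant:
  assumes "finite V" "partition_on V \<pi>" "\<And>v. v \<in> V \<Longrightarrow> finite (L v)"
  shows "card {f \<in> PiE V L. \<forall>B\<in>\<pi>. \<forall>x\<in>B. \<forall>y\<in>B. f x = f y} =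
    (\<Prod>B\<in>\<pi>. card (\<Inter>v\<in>B. L v))"
proof -
  have fin: "finite \<pi>" using assms finite_elements by blast
  have ne: "B \<noteq> {}" and BV: "B \<subseteq> V" if "B \<in> \<pi>" for B
    using assms(2) that by (auto simp: partition_on_def)
  let ?b = "\<lambda>v. THE B. B \<in> \<pi> \<and> v \<in> B"
  have b: "?b v = B" if "B \<in> \<pi>" "v \<in> B" for B v
    using that assms(2) by (intro the_equality) (auto dest: partition_onD2 disjointD)
  have bV: "?b v \<in> \<pi> \<and> v \<in> ?b v" if "v \<in> V" for v
    using that assms(2) b by (metis UnionE partition_onD1)
  let ?r = "\<lambda>B. SOME v. v \<in> B"
  have r: "?r B \<in> B" if "B \<in> \<pi>" for B using ne[OF that] by (simp add: some_in_eq)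
  have "bij_betw (\<lambda>f. \<lambda>B\<in>\<pi>. f (?r B))
     {f \<in> PiE V L. \<forall>B\<in>\<pi>. \<forall>x\<in>B. \<forall>y\<in>B. f x = f y} (PiE \<pi> (\<lambda>B. \<Inter>v\<in>B. L v))"
  proof (rule bij_betw_byWitness[where f' = "\<lambda>g. \<lambda>v\<in>V. g (?b v)"])
    show "\<forall>f\<in>{f \<in> PiE V L. \<forall>B\<in>\<pi>. \<forall>x\<in>B. \<forall>y\<in>B. f x = f y}.
       (\<lambda>v\<in>V. (\<lambda>B\<in>\<pi>. f (?r B)) (?b v)) = f"
    proof
      fix f assume f: "f \<in> {f \<in> PiE V L. \<forall>B\<in>\<pi>. \<forall>x\<in>B. \<forall>y\<in>B. f x = f y}"
      show "(\<lambda>v\<in>V. (\<lambda>B\<in>\<pi>. f (?r B)) (?b v)) = f"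
      proof
        fix v
        show "(\<lambda>v\<in>V. (\<lambda>B\<in>\<pi>. f (?r B)) (?b v)) v = f v"
        proof (cases "v \<in> V")
          case True
          then show ?thesis using f bV[OF True] r[of "?b v"] by auto
        next
          case False
          then show ?thesis using f by (auto simp: PiE_iff extensional_def)
        qed
      qed
    qed
    show "\<forall>g\<in>PiE \<pi> (\<lambda>B. \<Inter>v\<in>B. L v). (\<lambda>B\<in>\<pi>. (\<lambda>v\<in>V. g (?b v)) (?r B)) = g"
    proof
      fix g assume g: "g \<in> PiE \<pi> (\<lambda>B. \<Inter>v\<in>B. L v)"
      show "(\<lambda>B\<in>\<pi>. (\<lambda>v\<in>V. g (?b v)) (?r B)) = g"
      proof
        fix B
        show "(\<lambda>B\<in>\<pi>. (\<lambda>v\<in>V. g (?b v)) (?r B)) B = g B"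
        proof (cases "B \<in> \<pi>")
          case True
          have "?r B \<in> V" using r[OF True] BV[OF True] by blast
          then show ?thesis using True b[OF True r[OF True]] by simp
        next
          case False
          then show ?thesis using g by (auto simp: PiE_iff extensional_def)
        qed
      qed
    qed
    show "(\<lambda>f. \<lambda>B\<in>\<pi>. f (?r B)) ` {f \<in> PiE V L. \<forall>B\<in>\<pi>. \<forall>x\<in>B. \<forall>y\<in>B. f x = f y}
      \<subseteq> PiE \<pi> (\<lambda>B. \<Inter>v\<in>B. L v)"
    proof (clarsimp simp: PiE_iff)
      fix f B v
      assume f: "\<forall>i\<in>V. f i \<in> L i" "\<forall>B\<in>\<pi>. \<forall>x\<in>B. \<forall>y\<in>B. f x = f y" and B: "B \<in> \<pi>" "v \<in> B"
      have "f (?r B) = f v" using f B r[OF B(1)] by blast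
      moreover have "f v \<in> L v" using f(1) B BV by blast
      ultimately show "f (?r B) \<in> L v" by (rule ssubst)
    qed
    show "(\<lambda>g. \<lambda>v\<in>V. g (?b v)) ` PiE \<pi> (\<lambda>B. \<Inter>v\<in>B. L v)
      \<subseteq> {f \<in> PiE V L. \<forall>B\<in>\<pi>. \<forall>x\<in>B. \<forall>y\<in>B. f x = f y}"
    proof
      fix f assume "f \<in> (\<lambda>g. \<lambda>v\<in>V. g (?b v)) ` PiE \<pi> (\<lambda>B. \<Inter>v\<in>B. L v)"
      then obtain g where g: "g \<in> PiE \<pi> (\<lambda>B. \<Inter>v\<in>B. L v)" "f = (\<lambda>v\<in>V. g (?b v))" by blast
      have "g (?b v) \<in> L v" if "v \<in> V" for v
        using g(1) bV[OF that] unfolding PiE_iff by blast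
      then have "f \<in> PiE V L" using g(2) by auto
      moreover have "f x = g B" if "B \<in> \<pi>" "x \<in> B" for B x
        using g(2) b[OF that] BV[OF that(1)] that by auto
      ultimately show "f \<in> {f \<in> PiE V L. \<forall>B\<in>\<pi>. \<forall>x\<in>B. \<forall>y\<in>B. f x = f y}" by simp
    qed
  qed
  then show ?thesis using fin by (simp add: bij_betw_same_card card_PiE)
qed

section \<open>Moebius sums weighted by colorings\<close>

lemma refines_singletons:
  assumes "partition_on V \<pi>"
  shows "refines V ((\<lambda>v. {v}) ` V) \<pi>"
  using assms partition_onD1[OF assms] by (auto simp: refines_def partition_on_singletons)

lemma partition_on_obtains:
  assumes "partition_on V \<pi>" "B \<in> \<pi>"
  obtains x where "x \<in> B" "x \<in> V"
proof -
  have "B \<noteq> {}" "B \<subseteq> V" using assms by (auto simp: partition_on_def)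
  then show ?thesis using that by blast
qed

text \<open>Since \<open>b\<close> is the minimum, the sum runs over the whole interval from
  \<open>b\<close> to \<open>x\<close>, and the recursion defining \<open>mobius\<close> makes it
  vanish unless this interval is a single point.\<close>

lemma (in finite_poset) sum_mobius_below:
  assumes "b \<in> P" "x \<in> P" "\<And>y. y \<in> P \<Longrightarrow> le b y"
  shows "(\<Sum>y\<in>{y \<in> P. le y x}. mobius b y) = (if x = b then 1 else 0)"
proof (cases "x = b")
  case True
  have "{y \<in> P. le y x} = {b}"
    using True assms antisym_le refl_le by (auto dest: antisymp_onD reflp_onD)
  then show ?thesis using True assms refl_le by (simp add: mobius.simps reflp_onD)
next
  case False
  let ?S = "{z \<in> P. le b z \<and> le z x \<and> z \<noteq> x}"
  have "{y \<in> P. le y x} = insert x ?S" using assms refl_le by (auto dest: reflp_onD)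
  moreover have "mobius b x = - (\<Sum>z\<in>?S. mobius b z)"
    by (subst mobius.simps) (use assms False in auto)
  ultimately show ?thesis using False finite_carrier by simp
qed

text \<open>Both sides count all \<open>f \<in> PiE V L\<close>, each weighted by the sum of the Moebius function below
  the partition into monochromatic components of \<open>f\<close>.\<close>

lemma mobius_sum_list_colorings:
  assumes "finite V" "P \<subseteq> bond_lattice V E" "(\<lambda>v. {v}) ` V \<in> P" "\<And>x. {x} \<notin> E"
    and "\<And>v. v \<in> V \<Longrightarrow> finite (L v)"
    and comp: "\<And>f. f \<in> PiE V L \<Longrightarrow> color_components V E f \<in> P"
  shows "(\<Sum>\<pi>\<in>P. finite_poset.mobius P (refines V) ((\<lambda>v. {v}) ` V) \<pi> *
            int (\<Prod>B\<in>\<pi>. card (\<Inter>v\<in>B. L v))) = int (card (list_colorings V E L))"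
proof -
  interpret finite_poset P "refines V"
    by (rule finite_poset_bond_lattice_subset[OF assms(1,2)])
  let ?bot = "(\<lambda>v. {v}) ` V"
  have bot: "refines V ?bot \<pi>" if "\<pi> \<in> P" for \<pi>
    using that assms(2) by (intro refines_singletons) (auto simp: bond_lattice_def)
  have finF: "finite (PiE V L)" using assms by (intro finite_PiE) auto
  have "(\<Sum>\<pi>\<in>P. mobius ?bot \<pi> * int (\<Prod>B\<in>\<pi>. card (\<Inter>v\<in>B. L v))) =
     (\<Sum>\<pi>\<in>P. \<Sum>f\<in>PiE V L. if refines V \<pi> (color_components V E f) then mobius ?bot \<pi> else 0)"
  proof (rule sum.cong[OF refl])
    fix \<pi> assume \<pi>: "\<pi> \<in> P"
    then have bl: "\<pi> \<in> bond_lattice V E" using assms by auto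
    \<comment> \<open>The product counts the functions constant on the blocks of \<pi>, that is,
      those whose component partition lies above \<pi>.\<close>
    have "(\<Prod>B\<in>\<pi>. card (\<Inter>v\<in>B. L v)) =
        card {f \<in> PiE V L. refines V \<pi> (color_components V E f)}"
      unfolding refines_color_components_iff[OF bl]
      using assms bl by (subst card_blockwise_constant) (auto simp: bond_lattice_def)
    then show "mobius ?bot \<pi> * int (\<Prod>B\<in>\<pi>. card (\<Inter>v\<in>B. L v)) =
      (\<Sum>f\<in>PiE V L. if refines V \<pi> (color_components V E f) then mobius ?bot \<pi> else 0)"
      using finF by (simp add: sum.inter_filter[symmetric])
  qed
  also have "\<dots> = (\<Sum>f\<in>PiE V L. \<Sum>\<pi>\<in>{\<pi> \<in> P. refines V \<pi> (color_components V E f)}. mobius ?bot \<pi>)"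
    using finite_carrier by (subst sum.swap) (simp add: sum.inter_filter)
  \<comment> \<open>By \<open>comp\<close> the component partition lies in \<open>P\<close>, so the
    inner sum is one to which \<open>sum_mobius_below\<close> applies; only the colorings with
    singleton components survive.\<close>
  also have "\<dots> = (\<Sum>f\<in>PiE V L. if color_components V E f = ?bot then 1 else 0)"
  proof (rule sum.cong[OF refl])
    fix f assume "f \<in> PiE V L"
    then show "(\<Sum>\<pi>\<in>{\<pi> \<in> P. refines V \<pi> (color_components V E f)}. mobius ?bot \<pi>) =
        (if color_components V E f = ?bot then 1 else 0)"
      by (intro sum_mobius_below assms(3) comp bot)
  qed
  also have "\<dots> = int (card {f \<in> PiE V L. color_components V E f = ?bot})"
    using finF by (simp flip: sum.inter_filter)
  also have "{f \<in> PiE V L. color_components V E f = ?bot} = list_colorings V E L"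
    using assms(4) by (simp add: color_components_eq_singletons_iff list_colorings_def)
  finally show ?thesis .
qed

section \<open>Ranks in bond lattices\<close>

lemma finite_bond_lattice: "finite V \<Longrightarrow> finite (bond_lattice V E)"
  using finitely_many_partition_on[of V] by (rule rev_finite_subset) (auto simp: bond_lattice_def)

text \<open>Mapping each block of \<sigma> to the block of \<pi> containing it is surjective. Were
  it injective as well, each block of \<pi> would contain just one block of \<sigma> and hence equal
  it.\<close>

lemma card_refines_less:
  assumes "finite V" "refines V \<sigma> \<pi>" "\<sigma> \<noteq> \<pi>"
  shows "card \<pi> < card \<sigma>"
proof -
  have \<sigma>: "partition_on V \<sigma>" and \<pi>: "partition_on V \<pi>"
    using assms(2) by (auto simp: refines_def)
  have fin: "finite \<sigma>" "finite \<pi>" using assms(1) \<sigma> \<pi> finite_elements by blast+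
  obtain h where h: "\<And>X. X \<in> \<sigma> \<Longrightarrow> h X \<in> \<pi> \<and> X \<subseteq> h X"
    using assms(2) unfolding refines_def by metis
  have surj: "h ` \<sigma> = \<pi>"
  proof
    show "h ` \<sigma> \<subseteq> \<pi>" using h by auto
    show "\<pi> \<subseteq> h ` \<sigma>"
    proof
      fix Y assume Y: "Y \<in> \<pi>"
      then obtain y where y: "y \<in> Y" "y \<in> V" using partition_on_obtains[OF \<pi>] by blast
      then obtain X where X: "X \<in> \<sigma>" "y \<in> X" using \<sigma> by (auto simp: partition_on_def)
      then have "h X = Y" using h[of X] y Y \<pi> by (meson disjointD disjoint_iff partition_onD2 subsetD)
      then show "Y \<in> h ` \<sigma>" using X by auto
    qed
  qed
  have "card \<pi> \<noteq> card \<sigma>"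
  proof
    assume "card \<pi> = card \<sigma>"
    then have inj: "inj_on h \<sigma>" using surj fin by (simp add: eq_card_imp_inj_on)
    have "h X = X" if X: "X \<in> \<sigma>" for X
    proof
      show "X \<subseteq> h X" using h X by auto
      show "h X \<subseteq> X"
      proof
        fix y assume y: "y \<in> h X"
        then have "y \<in> V" using h[OF X] \<pi> by (auto simp: partition_on_def)
        then obtain Z where Z: "Z \<in> \<sigma>" "y \<in> Z" using \<sigma> by (auto simp: partition_on_def)
        then have "h Z = h X"
          using h[OF Z(1)] h[OF X] y \<pi> by (meson disjointD disjoint_iff partition_onD2 subsetD)
        then show "y \<in> X" using inj Z X by (auto dest: inj_onD)
      qed
    qed
    then show False using surj assms(3) by auto
  qed
  moreover have "card \<pi> \<le> card \<sigma>" using surj fin(1) card_image_le by blast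
  ultimately show ?thesis by simp
qed

section \<open>Merging blocks and maximal chains\<close>

lemma induced_connected_Un:
  assumes "induced_connected E A" "induced_connected E B" "a \<in> A" "b \<in> B" "{a, b} \<in> E"
  shows "induced_connected E (A \<union> B)"
  unfolding induced_connected_def
proof (intro ballI)
  let ?R = "\<lambda>S. {(x, y). x \<in> S \<and> y \<in> S \<and> {x, y} \<in> E}"
  have mono: "(?R A)\<^sup>* \<subseteq> (?R (A \<union> B))\<^sup>*" "(?R B)\<^sup>* \<subseteq> (?R (A \<union> B))\<^sup>*"
    by (intro rtrancl_mono; blast)+
  have A: "(x, y) \<in> (?R (A \<union> B))\<^sup>*" if "x \<in> A" "y \<in> A" for x y
    using assms(1) that mono(1) unfolding induced_connected_def by blast
  have B: "(x, y) \<in> (?R (A \<union> B))\<^sup>*" if "x \<in> B" "y \<in> B" for x y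
    using assms(2) that mono(2) unfolding induced_connected_def by blast
  have ab: "(a, b) \<in> (?R (A \<union> B))\<^sup>*" "(b, a) \<in> (?R (A \<union> B))\<^sup>*"
    using assms(3-5) by (auto simp: insert_commute)
  fix u v assume "u \<in> A \<union> B" "v \<in> A \<union> B"
  then consider "u \<in> A" "v \<in> A" | "u \<in> A" "v \<in> B" | "u \<in> B" "v \<in> A" | "u \<in> B" "v \<in> B" by blast
  then show "(u, v) \<in> (?R (A \<union> B))\<^sup>*"
  proof cases
    case 2
    then show ?thesis using A[of u a] ab(1) B[of b v] assms(3,4) by (meson rtrancl_trans)
  next
    case 3
    then show ?thesis using B[of u b] ab(2) A[of a v] assms(3,4) by (meson rtrancl_trans)
  qed (use A B in auto)
qed

lemma rtrancl_leaves_set: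
  assumes "(x, z) \<in> R\<^sup>*" "x \<in> A" "z \<notin> A"
  shows "\<exists>u v. (u, v) \<in> R \<and> u \<in> A \<and> v \<notin> A"
  using assms by (induction rule: rtrancl_induct) blast+

lemma partition_on_subset_eq:
  assumes "partition_on V \<sigma>" "partition_on V \<pi>" "\<pi> \<subseteq> \<sigma>"
  shows "\<pi> = \<sigma>"
proof
  show "\<sigma> \<subseteq> \<pi>"
  proof
    fix B assume B: "B \<in> \<sigma>"
    then obtain x where x: "x \<in> B" "x \<in> V" using partition_on_obtains[OF assms(1)] by blast
    then obtain C where C: "C \<in> \<pi>" "x \<in> C" using assms(2) by (auto simp: partition_on_def)
    then have "B = C" using assms B x by (meson disjointD disjoint_iff partition_onD2 subsetD)
    then show "B \<in> \<pi>" using C by simp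
  qed
qed fact

text \<open>One upward step inside the interval: some block \<open>C\<close> of \<pi> properly
  contains a block \<open>B\<close> of \<sigma>. As \<open>C\<close> is connected, an edge leaves
  \<open>B\<close> within \<open>C\<close> and reaches another block \<open>D\<close> of \<sigma>;
  fusing \<open>B\<close> and \<open>D\<close> gives a connected block still contained in
  \<open>C\<close>.\<close>

lemma bond_lattice_merge:
  assumes "finite V" "\<sigma> \<in> bond_lattice V E" "\<pi> \<in> bond_lattice V E" "refines V \<sigma> \<pi>" "\<sigma> \<noteq> \<pi>"
  obtains \<tau> where "\<tau> \<in> bond_lattice V E" "refines V \<sigma> \<tau>" "refines V \<tau> \<pi>" "Suc (card \<tau>) = card \<sigma>"
proof -
  have \<sigma>: "partition_on V \<sigma>" and \<pi>: "partition_on V \<pi>"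
    and conn: "\<And>B. B \<in> \<sigma> \<Longrightarrow> induced_connected E B" "\<And>B. B \<in> \<pi> \<Longrightarrow> induced_connected E B"
    using assms by (auto simp: bond_lattice_def)
  have inside: "B \<subseteq> C" if "B \<in> \<sigma>" "C \<in> \<pi>" "x \<in> B" "x \<in> C" for B C x
  proof -
    obtain C' where C': "C' \<in> \<pi>" "B \<subseteq> C'" using assms(4) \<open>B \<in> \<sigma>\<close> by (auto simp: refines_def)
    then have "C' = C" using that \<pi> by (meson disjointD disjoint_iff partition_onD2 subsetD)
    then show ?thesis using C' by simp
  qed
  obtain C where C: "C \<in> \<pi>" "C \<notin> \<sigma>"
    using partition_on_subset_eq[OF \<sigma> \<pi>] assms(5) by blast
  then obtain x where x: "x \<in> C" "x \<in> V" using partition_on_obtains[OF \<pi>] by blast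
  then obtain B where B: "B \<in> \<sigma>" "x \<in> B" using \<sigma> by (auto simp: partition_on_def)
  then have "B \<subseteq> C" "B \<noteq> C" using inside C x by blast+
  then obtain z where z: "z \<in> C" "z \<notin> B" by blast
  have "(x, z) \<in> {(x, y). x \<in> C \<and> y \<in> C \<and> {x, y} \<in> E}\<^sup>*"
    using conn(2)[OF C(1)] x z unfolding induced_connected_def by blast
  then obtain u v where uv: "u \<in> B" "v \<notin> B" "v \<in> C" "{u, v} \<in> E"
    using rtrancl_leaves_set[of x z _ B] B z by blast
  have "v \<in> V" using uv(3) C \<pi> by (auto simp: partition_on_def)
  then obtain D where D: "D \<in> \<sigma>" "v \<in> D" using \<sigma> by (auto simp: partition_on_def)
  have DC: "D \<subseteq> C" using inside D C uv by blast
  have BD: "B \<noteq> D" using uv D by auto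
  let ?\<tau> = "insert (B \<union> D) (\<sigma> - {B, D})"
  have new: "B \<union> D \<notin> \<sigma> - {B, D}"
  proof
    assume "B \<union> D \<in> \<sigma> - {B, D}"
    then have "B \<union> D \<in> \<sigma>" "B \<union> D \<noteq> B" by auto
    then have "(B \<union> D) \<inter> B = {}" using B \<sigma> by (meson disjointD partition_onD2)
    then show False using B by auto
  qed
  have part: "partition_on V ?\<tau>"
  proof (rule partition_onI)
    show "\<Union>?\<tau> = V" using \<sigma> B D by (auto simp: partition_on_def)
    show "{} \<notin> ?\<tau>" using \<sigma> B by (auto simp: partition_on_def)
    have dis: "X \<inter> Y = {}" if "X \<in> \<sigma>" "Y \<in> \<sigma>" "X \<noteq> Y" for X Y
      using that \<sigma> by (meson disjointD partition_onD2)
    have dis': "X \<inter> (B \<union> D) = {}" if "X \<in> \<sigma> - {B, D}" for X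
      using that dis[of X B] dis[of X D] B(1) D(1) by blast
    show "disjnt p q" if pq: "p \<in> ?\<tau>" "q \<in> ?\<tau>" "p \<noteq> q" for p q
    proof -
      consider "p = B \<union> D" "q \<in> \<sigma> - {B, D}" | "q = B \<union> D" "p \<in> \<sigma> - {B, D}"
        | "p \<in> \<sigma>" "q \<in> \<sigma>"
        using pq by blast
      then show ?thesis
        by cases (use pq(3) dis dis' in \<open>auto simp: disjnt_def Int_commute\<close>)
    qed
  qed
  show ?thesis
  proof
    show "?\<tau> \<in> bond_lattice V E"
      using part conn(1) induced_connected_Un[OF conn(1)[OF B(1)] conn(1)[OF D(1)] uv(1) D(2) uv(4)]
      by (auto simp: bond_lattice_def)
    show "refines V \<sigma> ?\<tau>" using \<sigma> part by (fastforce simp: refines_def)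
    show "refines V ?\<tau> \<pi>"
      using part \<pi> assms(4) C(1) \<open>B \<subseteq> C\<close> DC by (auto simp: refines_def)
    have "finite \<sigma>" using assms(1) \<sigma> finite_elements by blast
    moreover have "card {B, D} \<le> card \<sigma>" using \<open>finite \<sigma>\<close> B D by (intro card_mono) auto
    ultimately show "Suc (card ?\<tau>) = card \<sigma>"
      using new B D BD by (simp add: card_Diff_subset)
  qed
qed

text \<open>Repeated merging removes one block at a time, so the chain passes through every block
  count from \<open>card \<sigma>\<close> down to \<open>card \<pi>\<close>.\<close>

lemma bond_lattice_chain:
  assumes "finite V" "\<sigma> \<in> bond_lattice V E" "\<pi> \<in> bond_lattice V E" "refines V \<sigma> \<pi>"
  shows "\<exists>C \<subseteq> bond_lattice V E. (\<forall>\<rho>\<in>C. refines V \<sigma> \<rho> \<and> refines V \<rho> \<pi>) \<and>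
    totalp_on C (refines V) \<and> C \<noteq> {} \<and> card C = Suc (card \<sigma> - card \<pi>)"
  using assms(2,4)
proof (induction "card \<sigma>" arbitrary: \<sigma> rule: less_induct)
  case less
  have part: "partition_on V \<sigma>" using less.prems by (simp add: bond_lattice_def)
  show ?case
  proof (cases "\<sigma> = \<pi>")
    case True
    then show ?thesis using less.prems part
      by (intro exI[of _ "{\<pi>}"]) (auto intro: refines_refl totalp_onI)
  next
    case False
    obtain \<tau> where \<tau>: "\<tau> \<in> bond_lattice V E" "refines V \<sigma> \<tau>" "refines V \<tau> \<pi>" "Suc (card \<tau>) = card \<sigma>"
      using bond_lattice_merge[OF assms(1) less.prems(1) assms(3) less.prems(2) False] by metis
    obtain C where C: "C \<subseteq> bond_lattice V E" "\<forall>\<rho>\<in>C. refines V \<tau> \<rho> \<and> refines V \<rho> \<pi>"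
      "totalp_on C (refines V)" "C \<noteq> {}" "card C = Suc (card \<tau> - card \<pi>)"
      using less.hyps[of \<tau>] \<tau> by auto
    have fin: "finite C" using C(1) finite_bond_lattice[OF assms(1)] finite_subset by blast
    have le: "refines V \<sigma> \<rho>" if "\<rho> \<in> C" for \<rho> using that C(2) \<tau>(2) refines_trans by blast
    have "\<sigma> \<notin> C"
    proof
      assume "\<sigma> \<in> C"
      then have "\<sigma> = \<tau>" using C(2) \<tau>(2) refines_asym by blast
      then show False using \<tau>(4) by simp
    qed
    moreover have "card \<pi> \<le> card \<tau>"
      using card_refines_less[OF assms(1) \<tau>(3)] by (cases "\<tau> = \<pi>") auto
    ultimately have "card (insert \<sigma> C) = Suc (card \<sigma> - card \<pi>)"
      using fin C(5) \<tau>(4) by simp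
    moreover have "totalp_on (insert \<sigma> C) (refines V)"
      using C(3) le by (auto simp: totalp_on_def)
    ultimately show ?thesis
      using C less.prems le part by (intro exI[of _ "insert \<sigma> C"]) (auto intro: refines_refl)
  qed
qed

lemma singletons_in_bond_lattice: "(\<lambda>v. {v}) ` V \<in> bond_lattice V E"
  by (auto simp: bond_lattice_def induced_connected_def partition_on_singletons)

text \<open>Block counts are strictly monotone along chains, which bounds the length; merging from
  the singletons up to \<pi> attains the bound. This serves both for the length of a poset, with
  \<pi> of fewest blocks, and for the rank of \<pi>, with \<open>P\<close> its principal
  ideal.\<close>

lemma poset_length_bond_lattice_subset:
  assumes "finite V" "P \<subseteq> bond_lattice V E" "\<pi> \<in> P"
    and min: "\<And>\<rho>. \<rho> \<in> P \<Longrightarrow> card \<pi> \<le> card \<rho>"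
    and below: "\<And>\<rho>. \<rho> \<in> bond_lattice V E \<Longrightarrow> refines V \<rho> \<pi> \<Longrightarrow> \<rho> \<in> P"
  shows "poset_length P (refines V) = card V - card \<pi>"
  unfolding poset_length_def
proof (rule Max_eqI)
  let ?bot = "(\<lambda>v. {v}) ` V"
  have finP: "finite P" using assms finite_bond_lattice finite_subset by blast
  show "finite {card C - 1 | C. C \<subseteq> P \<and> C \<noteq> {} \<and> totalp_on C (refines V)}"
    using finP by simp
  have card_bot: "card ?bot = card V" by (simp add: card_image)
  have card_le: "card \<rho> \<le> card V" if "\<rho> \<in> bond_lattice V E" for \<rho>
  proof (cases "\<rho> = ?bot")
    case False
    then show ?thesis
      using card_refines_less[OF assms(1) refines_singletons, of \<rho>] that card_bot
      by (auto simp: bond_lattice_def)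
  qed (simp add: card_bot)
  show "y \<le> card V - card \<pi>"
    if y: "y \<in> {card C - 1 | C. C \<subseteq> P \<and> C \<noteq> {} \<and> totalp_on C (refines V)}" for y
  proof -
    obtain C where C: "y = card C - 1" "C \<subseteq> P" "C \<noteq> {}" "totalp_on C (refines V)"
      using y by blast
    have "inj_on card C"
    proof (rule inj_onI, rule ccontr)
      fix \<rho> \<rho>' assume *: "\<rho> \<in> C" "\<rho>' \<in> C" "card \<rho> = card \<rho>'" "\<rho> \<noteq> \<rho>'"
      then have "refines V \<rho> \<rho>' \<or> refines V \<rho>' \<rho>" using C(4) by (auto simp: totalp_on_def)
      then show False using card_refines_less[OF assms(1)] * by force
    qed
    moreover have "card \<pi> \<le> card \<rho> \<and> card \<rho> \<le> card V" if "\<rho> \<in> C" for \<rho>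
      using that C(2) assms(2) by (intro conjI min card_le) auto
    then have "card ` C \<subseteq> {card \<pi>..card V}" by auto
    ultimately have "card C \<le> card {card \<pi>..card V}"
      by (metis card_image card_mono finite_atLeastAtMost)
    then show ?thesis using C(1) by simp
  qed
  have \<pi>: "\<pi> \<in> bond_lattice V E" using assms by auto
  then have "refines V ?bot \<pi>" by (intro refines_singletons) (simp add: bond_lattice_def)
  from bond_lattice_chain[OF assms(1) singletons_in_bond_lattice \<pi> this]
  obtain C where C: "C \<subseteq> bond_lattice V E" "\<forall>\<rho>\<in>C. refines V \<rho> \<pi>"
    "totalp_on C (refines V)" "C \<noteq> {}" "card C = Suc (card V - card \<pi>)"
    using card_bot by auto
  then have "C \<subseteq> P" using below by blast
  then show "card V - card \<pi> \<in> {card C - 1 | C. C \<subseteq> P \<and> C \<noteq> {} \<and> totalp_on C (refines V)}"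
    using C by (auto intro!: exI[of _ C])
qed

section \<open>Pinned vertices\<close>

text \<open>The vertices of \<open>W\<close> are pinned to prescribed distinct colors; no two of them may share
  a block.\<close>

definition separating_bonds :: "'v set \<Rightarrow> 'v set set \<Rightarrow> 'v set \<Rightarrow> 'v set set set" where
  "separating_bonds V E W =
     {\<pi> \<in> bond_lattice V E. \<forall>B\<in>\<pi>. \<forall>x\<in>B \<inter> W. \<forall>y\<in>B \<inter> W. x = y}"

lemma separating_bonds_refines:
  assumes "\<pi> \<in> separating_bonds V E W" "\<rho> \<in> bond_lattice V E" "refines V \<rho> \<pi>"
  shows "\<rho> \<in> separating_bonds V E W"
  unfolding separating_bonds_def mem_Collect_eq
proof (intro conjI ballI)
  fix B x y assume *: "B \<in> \<rho>" "x \<in> B \<inter> W" "y \<in> B \<inter> W"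
  then obtain C where "C \<in> \<pi>" "B \<subseteq> C" using assms(3) by (auto simp: refines_def)
  then have "x \<in> C \<inter> W" "y \<in> C \<inter> W" using * by auto
  then show "x = y" using assms(1) \<open>C \<in> \<pi>\<close> unfolding separating_bonds_def by blast
qed fact

lemma singletons_in_separating_bonds: "(\<lambda>v. {v}) ` V \<in> separating_bonds V E W"
  using singletons_in_bond_lattice by (auto simp: separating_bonds_def)

text \<open>Sending a pinned vertex to its block is injective because no block holds two of
  them.\<close>

lemma card_pinned_blocks:
  assumes "\<pi> \<in> separating_bonds V E W" "W \<subseteq> V"
  shows "card {B \<in> \<pi>. B \<inter> W \<noteq> {}} = card W"
proof -
  have part: "partition_on V \<pi>" and sep: "\<And>B x y. B \<in> \<pi> \<Longrightarrow> x \<in> B \<inter> W \<Longrightarrow> y \<in> B \<inter> W \<Longrightarrow> x = y"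
    using assms by (auto simp: separating_bonds_def bond_lattice_def)
  let ?b = "\<lambda>v. THE B. B \<in> \<pi> \<and> v \<in> B"
  have b: "?b v = B" if "B \<in> \<pi>" "v \<in> B" for B v
    using that part by (intro the_equality) (auto dest: partition_onD2 disjointD)
  have bV: "?b v \<in> \<pi> \<and> v \<in> ?b v" if "v \<in> V" for v
    using that part b by (metis UnionE partition_onD1)
  have "bij_betw ?b W {B \<in> \<pi>. B \<inter> W \<noteq> {}}"
  proof (rule bij_betw_imageI)
    show "inj_on ?b W"
    proof (rule inj_onI)
      fix x y assume *: "x \<in> W" "y \<in> W" "?b x = ?b y"
      show "x = y"
        using sep[of "?b x" x y] bV[of x] bV[of y] * assms(2) by auto
    qed
    show "?b ` W = {B \<in> \<pi>. B \<inter> W \<noteq> {}}"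
    proof (intro set_eqI iffI)
      fix B assume "B \<in> ?b ` W"
      then show "B \<in> {B \<in> \<pi>. B \<inter> W \<noteq> {}}" using bV assms(2) by blast
    next
      fix B assume "B \<in> {B \<in> \<pi>. B \<inter> W \<noteq> {}}"
      then obtain w where "B \<in> \<pi>" "w \<in> B" "w \<in> W" by blast
      then show "B \<in> ?b ` W" using b by blast
    qed
  qed
  then show ?thesis by (simp add: bij_betw_same_card)
qed

lemma card_ge_pinned:
  assumes "finite V" "\<pi> \<in> separating_bonds V E W" "W \<subseteq> V"
  shows "card W \<le> card \<pi>"
proof -
  have "finite \<pi>"
    using assms finite_elements by (auto simp: separating_bonds_def bond_lattice_def)
  then show ?thesis
    using card_mono[of \<pi> "{B \<in> \<pi>. B \<inter> W \<noteq> {}}"] card_pinned_blocks[OF assms(2,3)] by simp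
qed

definition pinned :: "'v set \<Rightarrow> ('v \<Rightarrow> 'c) \<Rightarrow> 'c set \<Rightarrow> 'v \<Rightarrow> 'c set" where
  "pinned W c Q v = (if v \<in> W then {c v} else Q)"

text \<open>A block with a pinned vertex \<open>w\<close> admits only the color \<open>c w\<close>,
  which lies in \<open>Q\<close>; any other block may take every color of \<open>Q\<close>. The
  exponent counts the blocks of the second kind.\<close>

lemma prod_pinned:
  assumes "finite V" "\<pi> \<in> separating_bonds V E W" "W \<subseteq> V" "c ` W \<subseteq> Q"
  shows "(\<Prod>B\<in>\<pi>. card (\<Inter>v\<in>B. pinned W c Q v)) = card Q ^ (card \<pi> - card W)"
proof -
  have part: "partition_on V \<pi>" and sep: "\<And>B x y. B \<in> \<pi> \<Longrightarrow> x \<in> B \<inter> W \<Longrightarrow> y \<in> B \<inter> W \<Longrightarrow> x = y"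
    using assms by (auto simp: separating_bonds_def bond_lattice_def)
  have fin: "finite \<pi>" using assms(1) part finite_elements by blast
  have "card (\<Inter>v\<in>B. pinned W c Q v) = (if B \<inter> W \<noteq> {} then 1 else card Q)" if B: "B \<in> \<pi>" for B
  proof (cases "B \<inter> W = {}")
    case True
    have "B \<noteq> {}" using part B by (auto simp: partition_on_def)
    then have "(\<Inter>v\<in>B. pinned W c Q v) = Q" using True by (auto simp: pinned_def)
    then show ?thesis using True by simp
  next
    case False
    then obtain w where w: "w \<in> B" "w \<in> W" by auto
    have eq: "pinned W c Q v = (if v = w then {c w} else Q)" if "v \<in> B" for v
    proof (cases "v \<in> W")
      case True
      then have "v = w" using sep[OF B] that w by blast
      then show ?thesis using True by (simp add: pinned_def)
    next
      case False
      then have "v \<noteq> w" using w by blast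
      then show ?thesis using False by (simp add: pinned_def)
    qed
    have cw: "c w \<in> Q" using w assms(4) by blast
    have "c w \<in> pinned W c Q v" if "v \<in> B" for v using eq[OF that] cw by simp
    moreover have "pinned W c Q w = {c w}" using eq[OF w(1)] by simp
    ultimately have "(\<Inter>v\<in>B. pinned W c Q v) = {c w}" using w(1) by blast
    then show ?thesis using False by simp
  qed
  then have "(\<Prod>B\<in>\<pi>. card (\<Inter>v\<in>B. pinned W c Q v)) =
      (\<Prod>B\<in>\<pi>. if B \<inter> W \<noteq> {} then 1 else card Q)" by simp
  also have "\<dots> = card Q ^ card {B \<in> \<pi>. B \<inter> W = {}}"
  proof -
    have "(\<Prod>B\<in>\<pi>. if B \<inter> W \<noteq> {} then 1 else card Q) = (\<Prod>B\<in>\<pi>. if B \<inter> W = {} then card Q else 1)"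
      by (intro prod.cong refl) simp
    then show ?thesis using fin by (simp flip: prod.inter_filter)
  qed
  also have "{B \<in> \<pi>. B \<inter> W = {}} = \<pi> - {B \<in> \<pi>. B \<inter> W \<noteq> {}}" by auto
  also have "card \<dots> = card \<pi> - card W"
    using fin card_pinned_blocks[OF assms(2,3)] by (subst card_Diff_subset) auto
  finally show ?thesis .
qed

text \<open>The poset has length \<open>card V - card W\<close>, witnessed by \<tau>, and \<pi> has
  rank \<open>card V - card \<pi>\<close>. So the power attached to \<pi> is
  \<open>card Q ^ (card \<pi> - card W)\<close>, which \<open>prod_pinned\<close> identifies with
  the weight in \<open>mobius_sum_list_colorings\<close>.\<close>

lemma poly_char_poly_separating_bonds:
  fixes c :: "'v \<Rightarrow> 'c"
  assumes "finite V" "W \<subseteq> V" "\<And>x. {x} \<notin> E" "finite Q" "inj_on c W" "c ` W \<subseteq> Q"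
    and top: "\<tau> \<in> separating_bonds V E W" "card \<tau> = card W"
  shows "poly (poset_char_poly (separating_bonds V E W) (refines V)) (of_nat (card Q)) =
    of_nat (card (list_colorings V E (pinned W c Q)))"
proof -
  let ?P = "separating_bonds V E W"
  let ?bot = "(\<lambda>v. {v}) ` V"
  have sub: "?P \<subseteq> bond_lattice V E" by (auto simp: separating_bonds_def)
  have bot: "poset_bot ?P (refines V) = ?bot"
    by (rule poset_bot_bond_lattice_subset[OF sub singletons_in_separating_bonds])
  have len: "poset_length ?P (refines V) = card V - card W"
    using poset_length_bond_lattice_subset[OF assms(1) sub top(1)] separating_bonds_refines[OF top(1)]
      card_ge_pinned assms top by metis
  have rank: "poset_rank ?P (refines V) \<pi> = card V - card \<pi>" if \<pi>: "\<pi> \<in> ?P" for \<pi>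
    unfolding poset_rank_def
  proof (rule poset_length_bond_lattice_subset[OF assms(1), where E = E])
    show "\<pi> \<in> {y \<in> ?P. refines V y \<pi>}"
      using \<pi> sub by (auto intro!: refines_refl simp: bond_lattice_def)
    show "card \<pi> \<le> card \<rho>" if "\<rho> \<in> {y \<in> ?P. refines V y \<pi>}" for \<rho>
      using card_refines_less[OF assms(1), of \<rho> \<pi>] that by (cases "\<rho> = \<pi>") auto
  qed (use \<pi> sub separating_bonds_refines in auto)
  have card_le: "card \<pi> \<le> card V" if "\<pi> \<in> ?P" for \<pi>
  proof (cases "\<pi> = ?bot")
    case False
    then show ?thesis
      using card_refines_less[OF assms(1) refines_singletons, of \<pi>] that sub
      by (auto simp: bond_lattice_def card_image)
  qed (simp add: card_image)
  let ?\<mu> = "finite_poset.mobius ?P (refines V) ?bot"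
  \<comment> \<open>On \<open>W\<close> the function \<open>f\<close> takes the distinct colors
    prescribed by \<open>c\<close>, so a component, being monochromatic, contains at most one pinned
    vertex.\<close>
  have comp: "color_components V E f \<in> ?P" if f: "f \<in> PiE V (pinned W c Q)" for f
  proof -
    have "f x = c x" if "x \<in> W" for x
      using f that assms(2) PiE_mem[OF f, of x] by (auto simp: pinned_def)
    moreover have "f x = f y" if "B \<in> color_components V E f" "x \<in> B" "y \<in> B" for B x y
      using color_components_constant that by metis
    ultimately have "x = y" if "B \<in> color_components V E f" "x \<in> B \<inter> W" "y \<in> B \<inter> W" for B x y
      using that inj_onD[OF assms(5), of x y] by (metis IntD1 IntD2)
    then show ?thesis
      using color_components_in_bond_lattice[of V E f] unfolding separating_bonds_def by blast
  qed
  have "(\<Sum>\<pi>\<in>?P. ?\<mu> \<pi> * int (\<Prod>B\<in>\<pi>. card (\<Inter>v\<in>B. pinned W c Q v))) =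
      int (card (list_colorings V E (pinned W c Q)))"
    using assms(4) by (intro mobius_sum_list_colorings[OF assms(1) sub singletons_in_separating_bonds assms(3)] comp)
      (auto simp: pinned_def)
  then have "(\<Sum>\<pi>\<in>?P. ?\<mu> \<pi> * int (card Q ^ (card \<pi> - card W))) =
      int (card (list_colorings V E (pinned W c Q)))"
    using prod_pinned[OF assms(1) _ assms(2,6)] by simp
  then have *: "(\<Sum>\<pi>\<in>?P. of_int (?\<mu> \<pi>) * of_nat (card Q) ^ (card \<pi> - card W)) =
      (of_nat (card (list_colorings V E (pinned W c Q))) :: rat)"
    by (auto dest: arg_cong[where f = "of_int :: int \<Rightarrow> rat"])
  \<comment> \<open>The bounds \<open>card W \<le> card \<pi> \<le> card V\<close> make the
    truncated subtractions exact.\<close>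
  have "card V - card W - (card V - card \<pi>) = card \<pi> - card W" if "\<pi> \<in> ?P" for \<pi>
    using card_le[OF that] card_ge_pinned[OF assms(1) that assms(2)] by simp
  then show ?thesis
    unfolding poset_char_poly_def bot len
    by (simp add: poly_sum poly_monom rank flip: *)
qed

section \<open>Colorings of the graphs of the theorem\<close>

text \<open>Here \<open>m\<close> is the number of pairs still to be colored, \<open>k\<close> the
  number of colors already seen on odd vertices, and the variable stands for the palette size. At
  the value \<open>k + 1\<close>, where no new color remains, the second summand vanishes by
  itself.\<close>

fun pair_poly :: "nat \<Rightarrow> nat \<Rightarrow> rat poly" where
  "pair_poly 0 k = 1"
| "pair_poly (Suc m) k = of_nat k * (tvar - of_nat k) * pair_poly m k +
     (tvar - 1 - of_nat k)\<^sup>2 * pair_poly m (Suc k)"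

lemma Gamma_edges_iff:
  "{x, y} \<in> Gamma_edges V \<longleftrightarrow> x \<in> V \<and> y \<in> V \<and> (x < y \<and> odd x \<and> even y \<or> y < x \<and> odd y \<and> even x)"
  by (auto simp: Gamma_edges_def doubleton_eq_iff)

lemma Gamma_edges_no_loop: "{x} \<notin> Gamma_edges V"
  using Gamma_edges_iff[of x x V] by simp

lemma list_colorings_Gamma_edges:
  "list_colorings V (Gamma_edges V) L = list_colorings V (Gamma_edges UNIV) L"
  by (rule list_colorings_cong) (auto simp: Gamma_edges_iff)

text \<open>This shape survives peeling off the smallest vertex: if odd, it is adjacent to exactly
  the remaining even vertices; if even, it has no remaining neighbor.\<close>

definition parity_lists :: "'c set \<Rightarrow> 'c set \<Rightarrow> nat \<Rightarrow> 'c set" where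
  "parity_lists A B v = (if odd v then A else B)"

text \<open>As \<open>s\<close> is even, the smallest vertex \<open>s+1\<close> is odd and its color
  \<open>c\<close> leaves the list of every even vertex. Then \<open>s+2\<close> has no neighbor
  left and contributes the bare factor \<open>card (B - {c})\<close>.\<close>

lemma list_colorings_pairs_step:
  fixes A B :: "'c set"
  assumes "even s" "finite A" "finite B"
  shows "card (list_colorings {s+1..s+2*Suc m} (Gamma_edges UNIV) (parity_lists A B)) =
    (\<Sum>c\<in>A. card (B - {c}) *
      card (list_colorings {s+2+1..s+2+2*m} (Gamma_edges UNIV) (parity_lists A (B - {c}))))"
proof -
  let ?G = "Gamma_edges UNIV"
  let ?V = "{s+2+1..s+2+2*m}"
  have set: "{s+1..s+2*Suc m} = insert (s+1) (insert (s+2) ?V)" by auto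
  have "card (list_colorings {s+1..s+2*Suc m} ?G (parity_lists A B)) =
     (\<Sum>c\<in>A. card (list_colorings (insert (s+2) ?V) ?G (parity_lists A (B - {c}))))"
    unfolding set using assms
    by (intro card_list_colorings_insert_eq) (auto simp: Gamma_edges_no_loop Gamma_edges_iff parity_lists_def)
  also have "\<dots> = (\<Sum>c\<in>A. \<Sum>d\<in>B - {c}. card (list_colorings ?V ?G (parity_lists A (B - {c}))))"
    using assms
    by (intro sum.cong refl card_list_colorings_insert_eq) (auto simp: Gamma_edges_no_loop Gamma_edges_iff parity_lists_def)
  finally show ?thesis by simp
qed

text \<open>The odd vertices avoid the color \<open>b\<close> of the last vertex; \<open>S\<close> is the set of colors used by
  the odd vertices already processed, which every later even vertex has to avoid.\<close>

lemma card_list_colorings_pairs: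
  assumes "even s" "finite Q" "b \<in> Q" "S \<subseteq> Q - {b}"
  shows "of_nat (card (list_colorings {s+1..s+2*m} (Gamma_edges UNIV) (parity_lists (Q - {b}) (Q - S)))) =
    poly (pair_poly m (card S)) (of_nat (card Q))"
  using assms(1,4)
proof (induction m arbitrary: s S)
  case 0
  then show ?case by (simp add: list_colorings_def)
next
  case (Suc m)
  let ?q = "of_nat (card Q) :: rat"
  let ?k = "card S"
  let ?N = "\<lambda>T. card (list_colorings {s+2+1..s+2+2*m} (Gamma_edges UNIV) (parity_lists (Q - {b}) (Q - T)))"
  have finS: "finite S" using Suc.prems assms(2) finite_subset by blast
  have N: "of_nat (?N T) = poly (pair_poly m (card T)) ?q" if "T \<subseteq> Q - {b}" for T
    using Suc.IH[of "s+2" T] Suc.prems that by simp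
  have cQ: "of_nat (card (Q - T)) = ?q - of_nat (card T)" if "T \<subseteq> Q" for T
    using that assms(2) card_mono[OF assms(2) that] finite_subset[OF that]
    by (simp add: card_Diff_subset of_nat_diff)
  \<comment> \<open>The next odd vertex either repeats a color of \<open>S\<close> or takes one
    outside \<open>insert b S\<close>.\<close>
  have split: "Q - {b} = S \<union> (Q - insert b S)" using Suc.prems by auto
  have "of_nat (card (list_colorings {s+1..s+2*Suc m} (Gamma_edges UNIV) (parity_lists (Q - {b}) (Q - S)))) =
     (\<Sum>c\<in>Q - {b}. of_nat (card (Q - insert c S)) * of_nat (?N (insert c S)) :: rat)"
  proof -
    have "Q - S - {c} = Q - insert c S" for c by blast
    then show ?thesis using Suc.prems(1) assms(2) by (subst list_colorings_pairs_step) simp_all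
  qed
  also have "\<dots> = (\<Sum>c\<in>S. of_nat (card (Q - insert c S)) * of_nat (?N (insert c S))) +
     (\<Sum>c\<in>Q - insert b S. of_nat (card (Q - insert c S)) * of_nat (?N (insert c S)))"
    unfolding split using finS assms(2) by (intro sum.union_disjoint) auto
  also have "(\<Sum>c\<in>S. of_nat (card (Q - insert c S)) * of_nat (?N (insert c S))) =
     (\<Sum>c\<in>S. (?q - of_nat ?k) * poly (pair_poly m ?k) ?q)"
  proof (rule sum.cong[OF refl])
    fix c assume "c \<in> S"
    then have "insert c S = S" by blast
    moreover have "S \<subseteq> Q" using Suc.prems by blast
    ultimately show "of_nat (card (Q - insert c S)) * of_nat (?N (insert c S)) =
      (?q - of_nat ?k) * poly (pair_poly m ?k) ?q"
      using cQ N Suc.prems(2) by simp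
  qed
  \<comment> \<open>A new color enlarges the used set by one. The even vertex of the pair then
    avoids \<open>insert c S\<close> but may still take the color \<open>b\<close>.\<close>
  also have "(\<Sum>c\<in>Q - insert b S. of_nat (card (Q - insert c S)) * of_nat (?N (insert c S))) =
     (\<Sum>c\<in>Q - insert b S. (?q - of_nat (Suc ?k)) * poly (pair_poly m (Suc ?k)) ?q)"
  proof (rule sum.cong[OF refl])
    fix c assume c: "c \<in> Q - insert b S"
    have "insert c S \<subseteq> Q - {b}" using c Suc.prems by auto
    moreover from this have "insert c S \<subseteq> Q" by auto
    moreover have "card (insert c S) = Suc ?k" using c finS by simp
    ultimately show "of_nat (card (Q - insert c S)) * of_nat (?N (insert c S)) =
      (?q - of_nat (Suc ?k)) * poly (pair_poly m (Suc ?k)) ?q"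
      using cQ[of "insert c S"] N[of "insert c S"] by simp
  qed
  also have "\<dots> = of_nat (card (Q - insert b S)) * ((?q - of_nat (Suc ?k)) * poly (pair_poly m (Suc ?k)) ?q)"
    by simp
  \<comment> \<open>The number of new colors excludes \<open>S\<close> and \<open>b\<close>, which
    yields the second factor of the square.\<close>
  also have "of_nat (card (Q - insert b S)) = ?q - of_nat (Suc ?k)"
  proof -
    have "insert b S \<subseteq> Q" "b \<notin> S" using Suc.prems assms(3) by auto
    then show ?thesis using cQ[of "insert b S"] finS by simp
  qed
  finally show ?case by (simp add: algebra_simps power2_eq_square)
qed

section \<open>Evaluation of the two characteristic polynomials\<close>

lemma poly_eqI_of_nat:
  fixes p q :: "rat poly"
  assumes "\<And>n. n \<ge> N \<Longrightarrow> poly p (of_nat n) = poly q (of_nat n)"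
  shows "p = q"
proof (rule ccontr)
  assume "p \<noteq> q"
  then have "finite {x. poly (p - q) x = 0}" by (intro poly_roots_finite) simp
  moreover have "of_nat ` {N..} \<subseteq> {x. poly (p - q) x = 0}" using assms by auto
  ultimately have "finite (of_nat ` {N..} :: rat set)" by (rule rev_finite_subset)
  then have "finite {N..}" by (rule finite_imageD) (simp add: inj_on_def)
  then show False using infinite_Ici by blast
qed

lemma induced_connected_star:
  assumes "c \<in> S" "\<And>v. v \<in> S \<Longrightarrow> v \<noteq> c \<Longrightarrow> {c, v} \<in> E"
  shows "induced_connected E S"
  unfolding induced_connected_def
proof (intro ballI)
  let ?R = "{(x, y). x \<in> S \<and> y \<in> S \<and> {x, y} \<in> E}"
  have *: "(c, v) \<in> ?R\<^sup>* \<and> (v, c) \<in> ?R\<^sup>*" if "v \<in> S" for v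
  proof (cases "v = c")
    case False
    then have "{c, v} \<in> E" using assms that by blast
    moreover from this have "{v, c} \<in> E" by (simp add: insert_commute)
    ultimately show ?thesis using assms(1) that by auto
  qed simp
  show "(u, v) \<in> ?R\<^sup>*" if "u \<in> S" "v \<in> S" for u v
    using *[OF that(1)] *[OF that(2)] by (meson rtrancl_trans)
qed

text \<open>Pin \<open>1\<close> to the color \<open>0\<close> and the last vertex to the color
  \<open>1\<close>, which takes a palette of at least two colors. Vertex \<open>1\<close> then
  counts as an odd vertex already processed, so \<open>S = {0}\<close> and \<open>k\<close> starts
  at \<open>1\<close>; the last vertex supplies \<open>b = 1\<close>, and \<open>?M\<close> consists
  of \<open>n\<close> pairs.\<close>

lemma chi_L_eq: "chi_L (2 * Suc n + 2) = pair_poly n 1"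
proof (rule poly_eqI_of_nat[where N = 2])
  fix q :: nat assume q: "q \<ge> 2"
  let ?N = "2 * Suc n + 2"
  let ?V = "L_vertices ?N" and ?G = "Gamma_edges UNIV :: nat set set"
  let ?W = "{1, ?N}"
  let ?c = "\<lambda>v. if v = 1 then 0 else (1::nat)"
  let ?Q = "{..<q}"
  let ?L = "pinned ?W ?c ?Q"
  let ?M = "{2+1..2+2*n}"
  have V: "?V = insert 1 (insert ?N ?M)" by (auto simp: L_vertices_def)
  have P: "L_poset ?N = separating_bonds ?V (Gamma_edges ?V) ?W"
    by (auto simp: L_poset_def separating_bonds_def Pi_Gamma_def)
  \<comment> \<open>These two stars, centered at \<open>1\<close> and \<open>?N\<close>, form a
    separating bond partition with just two blocks and so determine the length of the poset.\<close>
  let ?A = "insert 1 {v \<in> ?M. even v}" and ?B = "insert ?N {v \<in> ?M. odd v}"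
  have part: "partition_on ?V {?A, ?B}"
    unfolding V by (rule partition_onI) (auto simp: disjnt_def)
  have "induced_connected (Gamma_edges ?V) ?A"
    unfolding V by (rule induced_connected_star[of 1]) (auto simp: Gamma_edges_iff)
  moreover have "induced_connected (Gamma_edges ?V) ?B"
    unfolding V by (rule induced_connected_star[of ?N]) (auto simp: Gamma_edges_iff)
  ultimately have top: "{?A, ?B} \<in> separating_bonds ?V (Gamma_edges ?V) ?W"
    using part by (auto simp: separating_bonds_def bond_lattice_def)
  have "1 \<in> ?A" "1 \<notin> ?B" by simp_all
  then have "?A \<noteq> ?B" by blast
  then have AB: "card {?A, ?B} = card ?W" by simp
  have "poly (chi_L ?N) (of_nat (card ?Q)) =
      of_nat (card (list_colorings ?V (Gamma_edges ?V) ?L))"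
    unfolding chi_L_def P
    by (rule poly_char_poly_separating_bonds[OF _ _ _ _ _ _ top AB])
      (use q in \<open>auto simp: L_vertices_def Gamma_edges_no_loop inj_on_def\<close>)
  also have "card (list_colorings ?V (Gamma_edges ?V) ?L) = card (list_colorings ?V ?G ?L)"
    by (simp only: list_colorings_Gamma_edges)
  \<comment> \<open>The color \<open>0\<close> of vertex \<open>1\<close> disappears from all even
    lists; the pinned list \<open>{1}\<close> of \<open>?N\<close> stays as it is.\<close>
  also have "\<dots> = (\<Sum>a\<in>{0}. card (list_colorings (insert ?N ?M) ?G
      (\<lambda>w. if w = ?N then {1} else parity_lists ?Q (?Q - {a}) w)))"
    unfolding V
    by (rule card_list_colorings_insert_eq) (auto simp: Gamma_edges_no_loop Gamma_edges_iff pinned_def parity_lists_def)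
  also have "\<dots> = (\<Sum>a\<in>{0}. \<Sum>b\<in>{1}. card (list_colorings ?M ?G (parity_lists (?Q - {b}) (?Q - {a}))))"
    by (intro sum.cong refl card_list_colorings_insert_eq) (auto simp: Gamma_edges_no_loop Gamma_edges_iff parity_lists_def)
  finally show "poly (chi_L ?N) (of_nat q) = poly (pair_poly n 1) (of_nat q)"
    using card_list_colorings_pairs[of 2 ?Q 1 "{0}" n] q by simp
qed

text \<open>Every bond partition separates a single vertex, so \<open>W = {1}\<close> gives the
  whole bond lattice. Coloring in the order \<open>1\<close>, \<open>2\<close>, \<open>?N\<close>,
  \<open>?N - 1\<close>, each of the last three has exactly one neighbor already colored, hence
  \<open>q - 1\<close> choices; the count for \<open>?M\<close> is the same for every nonzero color
  of \<open>?N\<close>.\<close>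

lemma chi_Pi_eq: "chi_Pi (2 * Suc n + 2) = (tvar - 1) ^ 3 * pair_poly n 1"
proof (rule poly_eqI_of_nat[where N = 1])
  fix q :: nat assume q: "q \<ge> 1"
  let ?N = "2 * Suc n + 2"
  let ?V = "{1..?N}" and ?G = "Gamma_edges UNIV :: nat set set"
  let ?c = "\<lambda>v. 0 :: nat"
  let ?Q = "{..<q}"
  let ?L = "pinned {1} ?c ?Q"
  let ?M = "{2+1..2+2*n}"
  have V: "?V = insert 1 (insert 2 (insert ?N (insert (?N - 1) ?M)))" by auto
  have P: "Pi_Gamma ?V = separating_bonds ?V (Gamma_edges ?V) {1}"
    by (auto simp: separating_bonds_def Pi_Gamma_def)
  have "induced_connected (Gamma_edges ?V) {v \<in> ?V. even v \<or> v = 1}"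
    by (rule induced_connected_star[of 1]) (auto simp: Gamma_edges_iff)
  moreover have "induced_connected (Gamma_edges ?V) {v \<in> ?V. odd v \<or> v = ?N}"
    by (rule induced_connected_star[of ?N]) (auto simp: Gamma_edges_iff)
  ultimately have "induced_connected (Gamma_edges ?V)
      ({v \<in> ?V. even v \<or> v = 1} \<union> {v \<in> ?V. odd v \<or> v = ?N})"
    by (rule induced_connected_Un[where a = 1 and b = ?N]) (auto simp: Gamma_edges_iff)
  also have "{v \<in> ?V. even v \<or> v = 1} \<union> {v \<in> ?V. odd v \<or> v = ?N} = ?V" by auto
  finally have top: "{?V} \<in> separating_bonds ?V (Gamma_edges ?V) {1}"
    by (auto simp: separating_bonds_def bond_lattice_def partition_on_space)
  have "poly (chi_Pi ?N) (of_nat (card ?Q)) =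
      of_nat (card (list_colorings ?V (Gamma_edges ?V) ?L))"
    unfolding chi_Pi_def P
    by (rule poly_char_poly_separating_bonds[OF _ _ _ _ _ _ top])
      (use q in \<open>auto simp: Gamma_edges_no_loop\<close>)
  also have "card (list_colorings ?V (Gamma_edges ?V) ?L) = card (list_colorings ?V ?G ?L)"
    by (simp only: list_colorings_Gamma_edges)
  also have "\<dots> = (\<Sum>a\<in>{0}. card (list_colorings (insert 2 (insert ?N (insert (?N - 1) ?M))) ?G
      (parity_lists ?Q (?Q - {a}))))"
    unfolding V
    by (rule card_list_colorings_insert_eq) (auto simp: Gamma_edges_no_loop Gamma_edges_iff pinned_def parity_lists_def)
  also have "\<dots> = (\<Sum>a\<in>{0}. \<Sum>e\<in>?Q - {a}. card (list_colorings (insert ?N (insert (?N - 1) ?M)) ?G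
      (parity_lists ?Q (?Q - {a}))))"
    by (intro sum.cong refl card_list_colorings_insert_eq) (auto simp: Gamma_edges_no_loop Gamma_edges_iff parity_lists_def)
  also have "\<dots> = (\<Sum>a\<in>{0}. \<Sum>e\<in>?Q - {a}. \<Sum>b\<in>?Q - {a}.
      card (list_colorings (insert (?N - 1) ?M) ?G (parity_lists (?Q - {b}) (?Q - {a}))))"
    by (intro sum.cong refl card_list_colorings_insert_eq) (auto simp: Gamma_edges_no_loop Gamma_edges_iff parity_lists_def)
  also have "\<dots> = (\<Sum>a\<in>{0}. \<Sum>e\<in>?Q - {a}. \<Sum>b\<in>?Q - {a}. \<Sum>d\<in>?Q - {b}.
      card (list_colorings ?M ?G (parity_lists (?Q - {b}) (?Q - {a}))))"
    by (intro sum.cong refl card_list_colorings_insert_eq) (auto simp: Gamma_edges_no_loop Gamma_edges_iff parity_lists_def)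
  also have "\<dots> = (q - 1) * (\<Sum>b\<in>?Q - {0}. (q - 1) * card (list_colorings ?M ?G
      (parity_lists (?Q - {b}) (?Q - {0}))))"
    using q by simp
  finally have "poly (chi_Pi ?N) (of_nat q) =
    of_nat (q - 1) * (\<Sum>b\<in>?Q - {0}. of_nat (q - 1) * of_nat (card (list_colorings ?M ?G
      (parity_lists (?Q - {b}) (?Q - {0})))))" by simp
  also have "\<dots> = of_nat (q - 1) * (\<Sum>b\<in>?Q - {0}. of_nat (q - 1) * poly (pair_poly n 1) (of_nat q))"
    using card_list_colorings_pairs[of 2 ?Q _ "{0}" n] q by simp
  also have "\<dots> = poly ((tvar - 1) ^ 3 * pair_poly n 1) (of_nat q)"
    using q by (simp add: of_nat_diff power3_eq_cube)
  finally show "poly (chi_Pi ?N) (of_nat q) = poly ((tvar - 1) ^ 3 * pair_poly n 1) (of_nat q)" .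
qed

section \<open>Generating functions\<close>

lemma falling_0 [simp]: "falling a 0 = 1"
  and falling_Suc: "falling a (Suc m) = falling a m * (a - of_nat m)"
  by (simp_all add: falling_def)

lemma falling_Suc_shift: "falling a (Suc m) = a * falling (a - 1) m"
  unfolding falling_def prod.lessThan_Suc_shift by (simp add: algebra_simps)

definition pair_series :: "nat \<Rightarrow> rat poly fps" where
  "pair_series k = Abs_fps (\<lambda>m. pair_poly m k)"

text \<open>This is the recursion of \<open>pair_poly\<close> summed over the number of pairs; the
  constant \<open>1\<close> accounts for the case of no pairs.\<close>

lemma pair_series_rec:
  "(1 - fps_const (of_nat k * (tvar - of_nat k)) * fps_X) * pair_series k =
     1 + fps_const ((tvar - 1 - of_nat k)\<^sup>2) * fps_X * pair_series (Suc k)"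
proof (rule fps_ext)
  fix m
  show "fps_nth ((1 - fps_const (of_nat k * (tvar - of_nat k)) * fps_X) * pair_series k) m =
    fps_nth (1 + fps_const ((tvar - 1 - of_nat k)\<^sup>2) * fps_X * pair_series (Suc k)) m"
    by (cases m) (simp_all add: pair_series_def mult.assoc left_diff_distrib)
qed

lemma denom_Suc: "denom (Suc n) = denom n * (1 - fps_const (of_nat (Suc n) * (tvar - of_nat (Suc n))) * fps_X)"
  by (simp add: denom_def)

text \<open>Unroll \<open>pair_series_rec\<close> \<open>J\<close> times. The remainder carries only
  \<open>inv_denom J\<close>, since the factor of index \<open>Suc J\<close> is not yet split off
  from \<open>pair_series (Suc J)\<close>.\<close>

lemma pair_series_partial:
  "pair_series 1 = (\<Sum>j<J. fps_const ((falling (tvar - 2) j)\<^sup>2) * inv_denom (Suc j) * fps_X ^ j) +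
     fps_const ((falling (tvar - 2) J)\<^sup>2) * inv_denom J * fps_X ^ J * pair_series (Suc J)"
proof (induction J)
  case 0
  have "inv_denom 0 = 1" using denom_times_inv_denom[of 0] by (simp add: denom_def)
  then show ?case by simp
next
  case (Suc J)
  let ?a = "fps_const ((falling (tvar - 2) J)\<^sup>2)" and ?e = "fps_const ((tvar - 1 - of_nat (Suc J))\<^sup>2)"
  let ?d = "1 - fps_const (of_nat (Suc J) * (tvar - of_nat (Suc J))) * fps_X"
  \<comment> \<open>Expressing \<open>inv_denom J\<close> through \<open>inv_denom (Suc J)\<close>
    produces the factor \<open>?d\<close> to which \<open>pair_series_rec\<close> applies.\<close>
  have inv: "inv_denom J = inv_denom (Suc J) * ?d"
  proof -
    have "inv_denom J = inv_denom J * (denom (Suc J) * inv_denom (Suc J))"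
      by (simp add: denom_times_inv_denom)
    also have "\<dots> = (denom J * inv_denom J) * (inv_denom (Suc J) * ?d)"
      unfolding denom_Suc by (simp only: mult_ac)
    finally show ?thesis by (simp add: denom_times_inv_denom)
  qed
  have "?a * inv_denom J * fps_X ^ J * pair_series (Suc J) =
    ?a * inv_denom (Suc J) * fps_X ^ J * (?d * pair_series (Suc J))"
    unfolding inv by (simp only: mult_ac)
  also have "\<dots> = ?a * inv_denom (Suc J) * fps_X ^ J +
      (?a * ?e) * inv_denom (Suc J) * fps_X ^ Suc J * pair_series (Suc (Suc J))"
    unfolding pair_series_rec by (simp only: distrib_left power_Suc mult_ac mult_1_left mult_1_right)
  also have "?a * ?e = fps_const ((falling (tvar - 2) (Suc J))\<^sup>2)"
  proof -
    have "tvar - 1 - of_nat (Suc J) = tvar - 2 - of_nat J" by simp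
    then show ?thesis unfolding falling_Suc power_mult_distrib by (simp only: fps_const_mult)
  qed
  finally show ?case using Suc.IH by simp
qed

text \<open>Taking \<open>J = Suc m\<close> makes the remainder a multiple of
  \<open>fps_X ^ Suc m\<close>, which does not reach the coefficient of index
  \<open>m\<close>.\<close>

lemma pair_poly_eq_sum:
  "pair_poly m 1 = (\<Sum>j\<le>m. fps_nth (fps_const ((falling (tvar - 2) j)\<^sup>2) * inv_denom (Suc j)) (m - j))"
proof -
  have "pair_poly m 1 = fps_nth (pair_series 1) m" by (simp add: pair_series_def)
  also have "\<dots> = (\<Sum>j<Suc m. fps_nth (fps_const ((falling (tvar - 2) j)\<^sup>2) * inv_denom (Suc j)) (m - j))"
    unfolding pair_series_partial[of "Suc m"]
    by (simp add: fps_sum_nth fps_X_power_mult_right_nth mult.assoc mult.left_commute[of _ "fps_X ^ _"] fps_X_power_mult_nth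
        del: power_Suc sum.lessThan_Suc)
  finally show ?thesis by (simp add: lessThan_Suc_atMost)
qed

text \<open>The assumption compares the coefficients of index \<open>Suc n\<close>, to which only
  the terms \<open>f j\<close> with \<open>j \<le> n\<close> contribute; at index \<open>0\<close>
  both series vanish.\<close>

lemma suminf_fps_const_eq:
  assumes "\<And>n. p n = (\<Sum>j\<le>n. fps_nth (f j) (n - j))"
  shows "(\<Sum>n. fps_const (p n) * fps_X ^ Suc n) = (\<Sum>n. f n * fps_X ^ Suc n :: rat poly fps)"
proof -
  have "(\<Sum>n<m. fps_nth (fps_const (p n)) (m - Suc n)) = (\<Sum>n<m. fps_nth (f n) (m - Suc n))" for m
  proof (cases m)
    case (Suc k)
    have "(\<Sum>n<m. fps_nth (fps_const (p n)) (m - Suc n)) = (\<Sum>n<m. if n = k then p n else 0)"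
      unfolding Suc by (intro sum.cong) auto
    then show ?thesis using assms[of k] unfolding Suc by (simp add: lessThan_Suc_atMost)
  qed simp
  then show ?thesis
    using sums_fps_X_power[of "\<lambda>n. fps_const (p n)", THEN sums_unique]
      sums_fps_X_power[of f, THEN sums_unique] by simp
qed

theorem theorem5p7:
  shows "(\<Sum>n. fps_const (chi_Pi (2 * Suc n + 2)) * fps_X ^ Suc n) =
           fps_const (tvar - 1) *
           (\<Sum>n. fps_const ((falling (tvar - 1) (Suc n))\<^sup>2) * inv_denom (Suc n) * fps_X ^ Suc n)
       \<and> (\<Sum>n. fps_const (chi_L (2 * Suc n + 2)) * fps_X ^ Suc n) =
           (\<Sum>n. fps_const ((falling (tvar - 2) (Suc n - 1))\<^sup>2) * inv_denom (Suc n) * fps_X ^ Suc n)"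
proof
  let ?g = "\<lambda>n. fps_const ((falling (tvar - 2) n)\<^sup>2) * inv_denom (Suc n)"
  let ?h = "\<lambda>n. fps_const ((falling (tvar - 1) (Suc n))\<^sup>2) * inv_denom (Suc n)"
  show "(\<Sum>n. fps_const (chi_L (2 * Suc n + 2)) * fps_X ^ Suc n) =
           (\<Sum>n. fps_const ((falling (tvar - 2) (Suc n - 1))\<^sup>2) * inv_denom (Suc n) * fps_X ^ Suc n)"
    unfolding chi_L_eq diff_Suc_1 by (rule suminf_fps_const_eq) (rule pair_poly_eq_sum)
  \<comment> \<open>Squaring \<open>falling (tvar - 1) (Suc n)\<close> releases two factors
    \<open>tvar - 1\<close>, and the prefactor supplies the third, matching the cube in
    \<open>chi_Pi_eq\<close>.\<close>
  have h: "fps_const (tvar - 1) * ?h n = fps_const ((tvar - 1) ^ 3) * ?g n" for n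
  proof -
    have "tvar - 1 - 1 = tvar - 2" by simp
    then have "(tvar - 1) * (falling (tvar - 1) (Suc n))\<^sup>2 = (tvar - 1) ^ 3 * (falling (tvar - 2) n)\<^sup>2"
      unfolding falling_Suc_shift by (simp only: power_mult_distrib power3_eq_cube power2_eq_square mult_ac)
    then show ?thesis by (simp only: mult.assoc[symmetric] fps_const_mult)
  qed
  have "(\<Sum>n. fps_const (chi_Pi (2 * Suc n + 2)) * fps_X ^ Suc n) =
      (\<Sum>n. fps_const (tvar - 1) * ?h n * fps_X ^ Suc n)"
    unfolding chi_Pi_eq h
    by (rule suminf_fps_const_eq) (simp add: pair_poly_eq_sum sum_distrib_left mult.assoc del: One_nat_def)
  \<comment> \<open>The constant is moved out of the infinite sum by comparing coefficients.\<close>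
  also have "\<dots> = fps_const (tvar - 1) * (\<Sum>n. ?h n * fps_X ^ Suc n)"
  proof -
    have "(\<lambda>n. fps_const (tvar - 1) * ?h n * fps_X ^ Suc n) sums
        Abs_fps (\<lambda>m. \<Sum>n<m. fps_nth (fps_const (tvar - 1) * ?h n) (m - Suc n))"
      by (rule sums_fps_X_power)
    moreover have "Abs_fps (\<lambda>m. \<Sum>n<m. fps_nth (fps_const (tvar - 1) * ?h n) (m - Suc n)) =
        fps_const (tvar - 1) * Abs_fps (\<lambda>m. \<Sum>n<m. fps_nth (?h n) (m - Suc n))"
      by (rule fps_ext) (simp add: sum_distrib_left mult.assoc)
    ultimately show ?thesis
      using sums_fps_X_power[of ?h, THEN sums_unique] by (simp only: sums_iff)
  qed
  finally show "(\<Sum>n. fps_const (chi_Pi (2 * Suc n + 2)) * fps_X ^ Suc n) =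
           fps_const (tvar - 1) *
           (\<Sum>n. fps_const ((falling (tvar - 1) (Suc n))\<^sup>2) * inv_denom (Suc n) * fps_X ^ Suc n)"
    by (simp only: mult.assoc)
qed

end
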